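(* Let $A$ be a commutative MVW-rig with unitary element. Then $\mathrm{Spec}(A)$, equipped with the co-Zariski topology, is a compact topological space (every open cover has a finite subcover; no separation axiom is included).
   Context: An MV-algebra is a set $A$ with a binary operation $\oplus$, a unary operation $\neg$ and a constant $0$ such that for all $x,y,z\in A$: $x\oplus(y\oplus z)=(x\oplus y)\oplus z$; $x\oplus y=y\oplus x$; $x\oplus 0=x$; $x\oplus\neg 0=\neg 0$; $\neg\neg x=x$; $\neg(\neg x\oplus y)\oplus y=\neg(\neg y\oplus x)\oplus x$. Put $u=\neg 0$, $x\ominus y=\neg(\neg x\oplus y)$, and $x\le y$ iff $x\ominus y=0$; this is a lattice order with minimum $0$ and maximum $u$. An MVW-rig is a structure $(A,\oplus,\cdot,\neg,0)$ such that $(A,\oplus,\neg,0)$ is an MV-algebra, $\cdot$ is an associative binary operation on $A$ (written $ab$), and for all $a,b,c\in A$: $a0=0a=0$; $a(b\oplus c)\le ab\oplus ac$ and $(b\oplus c)a\le ba\oplus ca$; $a(b\ominus c)\ge ab\ominus ac$ and $(b\ominus c)a\ge ba\ominus ca$. It is commutative if $xy=yx$ for all $x,y\in A$; a unitary element is an element $1$ with $1x=x1=x$ for all $x\in A$ (not necessarily equal to $u$). An ideal of $A$ is a subset $I\subseteq A$ with $0\in I$; $a\le b$ and $b\in I$ imply $a\in I$; $a,b\in I$ imply $a\oplus b\in I$; $a\in I$ and $b\in A$ imply $ab,ba\in I$. A prime ideal is a proper ideal $P\neq A$ such that $ab\in P$ implies $a\in P$ or $b\in P$. $\mathrm{Spec}(A)$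 is the set of prime ideals of $A$, and for $a\in A$, $V(a)=\{P\in\mathrm{Spec}(A)\mid a\in P\}$. The co-Zariski topology on $\mathrm{Spec}(A)$ is the topology having $\{V(a)\}_{a\in A}$ as a base of open sets. *)

theory Defs
  imports "HOL-Analysis.Abstract_Topology"
begin

locale mv_algebra =
  fixes A :: "'a set"
    and oplus :: "'a \<Rightarrow> 'a \<Rightarrow> 'a"  (infixl "\<oplus>" 65)
    and neg :: "'a \<Rightarrow> 'a"
    and zero :: 'a  ("\<zero>")
  assumes zero_closed: "\<zero> \<in> A"
    and oplus_closed: "\<lbrakk>x \<in> A; y \<in> A\<rbrakk> \<Longrightarrow> x \<oplus> y \<in> A"
    and neg_closed: "x \<in> A \<Longrightarrow> neg x \<in> A"
    and oplus_assoc: "\<lbrakk>x \<in> A; y \<in> A; z \<in> A\<rbrakk> \<Longrightarrow> x \<oplus> (y \<oplus> z) = (x \<oplus> y) \<oplus> z"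
    and oplus_comm: "\<lbrakk>x \<in> A; y \<in> A\<rbrakk> \<Longrightarrow> x \<oplus> y = y \<oplus> x"
    and oplus_zero: "x \<in> A \<Longrightarrow> x \<oplus> \<zero> = x"
    and oplus_neg_zero: "x \<in> A \<Longrightarrow> x \<oplus> neg \<zero> = neg \<zero>"
    and neg_neg: "x \<in> A \<Longrightarrow> neg (neg x) = x"
    and lukasiewicz: "\<lbrakk>x \<in> A; y \<in> A\<rbrakk> \<Longrightarrow> neg (neg x \<oplus> y) \<oplus> y = neg (neg y \<oplus> x) \<oplus> x"
begin

definition ominus :: "'a \<Rightarrow> 'a \<Rightarrow> 'a"  (infixl "\<ominus>" 65)
  where "x \<ominus> y = neg (neg x \<oplus> y)"

definition leq :: "'a \<Rightarrow> 'a \<Rightarrow> bool"  (infix "\<preceq>" 50)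
  where "x \<preceq> y \<longleftrightarrow> x \<ominus> y = \<zero>"

lemma neg_oplus_self:
  assumes "x \<in> A"
  shows "neg x \<oplus> x = neg \<zero>"
proof -
  have "neg (neg x \<oplus> neg \<zero>) \<oplus> neg \<zero> = neg (neg (neg \<zero>) \<oplus> x) \<oplus> x"
    using assms by (intro lukasiewicz neg_closed zero_closed)
  moreover have "neg (neg \<zero>) \<oplus> x = x"
    using assms oplus_comm[of "\<zero>" x] by (simp add: oplus_zero neg_neg zero_closed)
  moreover have "neg (neg x \<oplus> neg \<zero>) \<oplus> neg \<zero> = neg \<zero>"
    using assms by (intro oplus_neg_zero neg_closed oplus_closed zero_closed)
  ultimately show ?thesis
    by simp
qed

lemma leq_oplus_left:
  assumes "x \<in> A" "y \<in> A"
  shows "x \<preceq> x \<oplus> y"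
proof -
  have "neg x \<oplus> (x \<oplus> y) = neg \<zero> \<oplus> y"
    using assms by (simp add: oplus_assoc neg_closed neg_oplus_self)
  also have "\<dots> = y \<oplus> neg \<zero>"
    using assms by (intro oplus_comm neg_closed zero_closed)
  also have "\<dots> = neg \<zero>"
    using assms by (simp add: oplus_neg_zero)
  finally have "neg x \<oplus> (x \<oplus> y) = neg \<zero>" .
  then show ?thesis
    using neg_neg zero_closed by (simp add: leq_def ominus_def)
qed

end

locale mvw_rig = mv_algebra A oplus neg zero
  for A :: "'a set"
    and oplus :: "'a \<Rightarrow> 'a \<Rightarrow> 'a"  (infixl "\<oplus>" 65)
    and neg :: "'a \<Rightarrow> 'a"
    and zero :: 'a  ("\<zero>") +
  fixes mult :: "'a \<Rightarrow> 'a \<Rightarrow> 'a"  (infixl "\<cdot>" 70)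
  assumes mult_closed: "\<lbrakk>a \<in> A; b \<in> A\<rbrakk> \<Longrightarrow> a \<cdot> b \<in> A"
    and mult_assoc: "\<lbrakk>a \<in> A; b \<in> A; c \<in> A\<rbrakk> \<Longrightarrow> (a \<cdot> b) \<cdot> c = a \<cdot> (b \<cdot> c)"
    and mult_zero: "a \<in> A \<Longrightarrow> a \<cdot> \<zero> = \<zero>"
    and zero_mult: "a \<in> A \<Longrightarrow> \<zero> \<cdot> a = \<zero>"
    and mult_oplus: "\<lbrakk>a \<in> A; b \<in> A; c \<in> A\<rbrakk> \<Longrightarrow> a \<cdot> (b \<oplus> c) \<preceq> a \<cdot> b \<oplus> a \<cdot> c"
    and oplus_mult: "\<lbrakk>a \<in> A; b \<in> A; c \<in> A\<rbrakk> \<Longrightarrow> (b \<oplus> c) \<cdot> a \<preceq> b \<cdot> a \<oplus> c \<cdot> a"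
    and mult_ominus: "\<lbrakk>a \<in> A; b \<in> A; c \<in> A\<rbrakk> \<Longrightarrow> a \<cdot> b \<ominus> a \<cdot> c \<preceq> a \<cdot> (b \<ominus> c)"
    and ominus_mult: "\<lbrakk>a \<in> A; b \<in> A; c \<in> A\<rbrakk> \<Longrightarrow> b \<cdot> a \<ominus> c \<cdot> a \<preceq> (b \<ominus> c) \<cdot> a"
begin

definition ideal :: "'a set \<Rightarrow> bool"
  where "ideal I \<longleftrightarrow> I \<subseteq> A \<and> \<zero> \<in> I
    \<and> (\<forall>a\<in>A. \<forall>b\<in>I. a \<preceq> b \<longrightarrow> a \<in> I)
    \<and> (\<forall>a\<in>I. \<forall>b\<in>I. a \<oplus> b \<in> I)
    \<and> (\<forall>a\<in>I. \<forall>b\<in>A. a \<cdot> b \<in> I \<and> b \<cdot> a \<in> I)"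

definition prime_ideal :: "'a set \<Rightarrow> bool"
  where "prime_ideal P \<longleftrightarrow> ideal P \<and> P \<noteq> A
    \<and> (\<forall>a\<in>A. \<forall>b\<in>A. a \<cdot> b \<in> P \<longrightarrow> a \<in> P \<or> b \<in> P)"

definition Spec :: "'a set set"
  where "Spec = {P. prime_ideal P}"

definition V :: "'a \<Rightarrow> 'a set set"
  where "V a = {P \<in> Spec. a \<in> P}"

definition co_zariski :: "'a set topology"
  where "co_zariski = topology (arbitrary union_of (\<lambda>U. \<exists>a\<in>A. U = V a))"

lemma V_zero: "V \<zero> = Spec"
  by (auto simp: V_def Spec_def prime_ideal_def ideal_def)

lemma V_oplus:
  assumes "a \<in> A" "b \<in> A"
  shows "V (a \<oplus> b) = V a \<inter> V b"
proof -
  have "a \<preceq> a \<oplus> b" "b \<preceq> a \<oplus> b"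
    using assms leq_oplus_left[of a b] leq_oplus_left[of b a] oplus_comm[of b a] by simp_all
  then have "a \<oplus> b \<in> P \<longleftrightarrow> a \<in> P \<and> b \<in> P" if "ideal P" for P
    using assms that unfolding ideal_def by blast
  then show ?thesis
    by (auto simp: V_def Spec_def prime_ideal_def)
qed

text \<open>The sets \<open>V a\<close> are closed under binary intersection, so they do form a base and
  \<^const>\<open>topology\<close> is applied to a genuine topology.\<close>

lemma openin_co_zariski: "openin co_zariski = arbitrary union_of (\<lambda>U. \<exists>a\<in>A. U = V a)"
proof -
  have "istopology (arbitrary union_of (\<lambda>U. \<exists>a\<in>A. U = V a))"
  proof (rule istopology_base)
    fix S T
    assume "\<exists>a\<in>A. S = V a" "\<exists>a\<in>A. T = V a"
    then obtain a b where "a \<in> A" "b \<in> A" "S = V a" "T = V b"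
      by blast
    then have "S \<inter> T = V (a \<oplus> b)" "a \<oplus> b \<in> A"
      by (simp_all add: V_oplus oplus_closed)
    then show "\<exists>a\<in>A. S \<inter> T = V a"
      by blast
  qed
  then show ?thesis
    by (simp add: co_zariski_def)
qed

lemma topspace_co_zariski: "topspace co_zariski = Spec"
proof
  show "topspace co_zariski \<subseteq> Spec"
    unfolding topspace_def openin_co_zariski union_of_def V_def by blast
  have "\<exists>a\<in>A. Spec = V a"
    using V_zero zero_closed by blast
  then have "openin co_zariski Spec"
    unfolding openin_co_zariski by (rule arbitrary_union_of_inc)
  then show "Spec \<subseteq> topspace co_zariski"
    by (rule openin_subset)
qed

end

end

theory Submission
  imports Defs
begin

text \<open>Given an open cover \<open>\<U>\<close> of the spectrum, consider the set \<open>S\<close> of all \<open>s\<close> such that \<open>V s\<close> is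
  covered by finitely many members of \<open>\<U>\<close>. It is multiplicatively closed, because
  \<open>V (s t) \<subseteq> V s \<union> V t\<close>, and it contains the unitary element. If \<open>0 \<in> S\<close>, then \<open>Spec = V 0\<close> is
  finitely covered. Otherwise an ideal that is maximal among those disjoint from \<open>S\<close> is prime; it
  lies in some basic open \<open>V a\<close> contained in a member of \<open>\<U>\<close>, so that \<open>a\<close> belongs both to it and
  to \<open>S\<close>, which is absurd.\<close>

context mvw_rig
begin

lemma leq_zero_iff:
  assumes "x \<in> A"
  shows "x \<preceq> \<zero> \<longleftrightarrow> x = \<zero>"
proof -
  have "x \<ominus> \<zero> = x"
    using assms by (simp add: ominus_def oplus_zero neg_closed neg_neg)
  then show ?thesis
    by (simp add: leq_def)
qed

text \<open>The axiom on differences forces this: if \<open>x \<ominus> y = \<zero>\<close>, then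
  \<open>x \<cdot> z \<ominus> y \<cdot> z\<close> lies below
  \<open>\<zero> \<cdot> z = \<zero>\<close>.\<close>

lemma mult_right_mono:
  assumes "x \<in> A" "y \<in> A" "z \<in> A" "x \<preceq> y"
  shows "x \<cdot> z \<preceq> y \<cdot> z"
proof -
  have "x \<cdot> z \<ominus> y \<cdot> z \<preceq> \<zero>"
    using ominus_mult[of z x y] assms by (simp add: leq_def zero_mult)
  moreover have "x \<cdot> z \<ominus> y \<cdot> z \<in> A"
    using assms by (simp add: ominus_def neg_closed oplus_closed mult_closed)
  ultimately show ?thesis
    by (simp add: leq_zero_iff) (simp add: leq_def)
qed

lemma idealI:
  assumes "I \<subseteq> A" "\<zero> \<in> I"
    and "\<And>a b. \<lbrakk>a \<in> A; b \<in> I; a \<preceq> b\<rbrakk> \<Longrightarrow> a \<in> I"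
    and "\<And>a b. \<lbrakk>a \<in> I; b \<in> I\<rbrakk> \<Longrightarrow> a \<oplus> b \<in> I"
    and "\<And>a b. \<lbrakk>a \<in> I; b \<in> A\<rbrakk> \<Longrightarrow> a \<cdot> b \<in> I \<and> b \<cdot> a \<in> I"
  shows "ideal I"
  unfolding ideal_def using assms by simp

text \<open>The zero ideal avoids every set without \<open>\<zero>\<close>, so it shows that the
  family in the Zorn argument is nonempty.\<close>

lemma ideal_zero: "ideal {\<zero>}"
proof -
  have "\<zero> \<oplus> \<zero> = \<zero>"
    using oplus_zero zero_closed by blast
  then show ?thesis
    unfolding ideal_def by (simp add: zero_closed leq_zero_iff mult_zero zero_mult)
qed

lemma ideal_Union_chain:
  assumes "subset.chain {I. ideal I} \<C>" "\<C> \<noteq> {}"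
  shows "ideal (\<Union>\<C>)"
proof -
  have ideals: "\<And>I. I \<in> \<C> \<Longrightarrow> ideal I"
    and chain: "\<And>I J. I \<in> \<C> \<Longrightarrow> J \<in> \<C> \<Longrightarrow> I \<subseteq> J \<or> J \<subseteq> I"
    using assms(1) by (auto simp: subset_chain_def)
  show ?thesis
  proof (rule idealI)
    show "a \<oplus> b \<in> \<Union>\<C>" if ab: "a \<in> \<Union>\<C>" "b \<in> \<Union>\<C>" for a b
    proof -
      \<comment> \<open>Of two members of the chain containing \<open>a\<close> and \<open>b\<close>
        respectively, the larger contains both.\<close>
      obtain I where "I \<in> \<C>" "a \<in> I" "b \<in> I"
        using ab chain by blast
      then show ?thesis
        using ideals[of I] unfolding ideal_def by blast
    qed
    show "\<zero> \<in> \<Union>\<C>"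
      using assms(2) ideals unfolding ideal_def by blast
    show "\<Union>\<C> \<subseteq> A"
      using ideals unfolding ideal_def by blast
    show "a \<in> \<Union>\<C>" if ab: "a \<in> A" "b \<in> \<Union>\<C>" "a \<preceq> b" for a b
    proof -
      obtain I where "I \<in> \<C>" "b \<in> I"
        using \<open>b \<in> \<Union>\<C>\<close> by blast
      then have "a \<in> I"
        using ideals[of I] ab unfolding ideal_def by blast
      then show ?thesis
        using \<open>I \<in> \<C>\<close> by blast
    qed
    show "a \<cdot> b \<in> \<Union>\<C> \<and> b \<cdot> a \<in> \<Union>\<C>" if ab: "a \<in> \<Union>\<C>" "b \<in> A" for a b
    proof -
      obtain I where "I \<in> \<C>" "a \<in> I"
        using \<open>a \<in> \<Union>\<C>\<close> by blast
      then have "a \<cdot> b \<in> I \<and> b \<cdot> a \<in> I"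
        using ideals[of I] ab unfolding ideal_def by blast
      then show ?thesis
        using \<open>I \<in> \<C>\<close> by blast
    qed
  qed
qed

lemma V_mult_subset:
  assumes "a \<in> A" "b \<in> A"
  shows "V (a \<cdot> b) \<subseteq> V a \<union> V b"
  using assms unfolding V_def Spec_def prime_ideal_def by blast

text \<open>An ideal containing \<open>one\<close> absorbs every \<open>x = one \<cdot> x\<close>,
  hence is all of \<open>A\<close>, whereas prime ideals are proper.\<close>

lemma V_one:
  assumes "\<And>x. x \<in> A \<Longrightarrow> one \<cdot> x = x"
  shows "V one = {}"
proof -
  have "P = A" if "ideal P" "one \<in> P" for P
    using that assms unfolding ideal_def by (metis subsetI subset_antisym)
  then show ?thesis
    by (auto simp: V_def Spec_def prime_ideal_def)
qed

lemma openin_co_zariski_basic: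
  assumes "openin co_zariski U" "P \<in> U"
  obtains a where "a \<in> A" "P \<in> V a" "V a \<subseteq> U"
proof -
  have "\<exists>a\<in>A. P \<in> V a \<and> V a \<subseteq> U"
    using assms unfolding openin_co_zariski union_of_def by blast
  then show thesis
    using that by blast
qed

end

locale comm_mvw_rig = mvw_rig +
  assumes mult_comm: "\<lbrakk>x \<in> A; y \<in> A\<rbrakk> \<Longrightarrow> x \<cdot> y = y \<cdot> x"
begin

text \<open>This is the colon ideal \<open>(P : b)\<close>. Although multiplication distributes only
  up to an inequality, \<open>(x \<oplus> y) \<cdot> b \<preceq> x \<cdot> b \<oplus> y \<cdot>
  b\<close> suffices because \<open>P\<close> is closed downwards. Commutativity and associativity
  turn both products of \<open>x\<close> and \<open>c\<close> into the case
  \<open>c \<cdot> (x \<cdot> b)\<close>.\<close>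

lemma ideal_colon:
  assumes P: "ideal P" and b: "b \<in> A"
  shows "ideal {x \<in> A. x \<cdot> b \<in> P}" (is "ideal ?J")
proof -
  have P_down: "\<And>x y. \<lbrakk>x \<in> A; y \<in> P; x \<preceq> y\<rbrakk> \<Longrightarrow> x \<in> P"
    and P_oplus: "\<And>x y. \<lbrakk>x \<in> P; y \<in> P\<rbrakk> \<Longrightarrow> x \<oplus> y \<in> P"
    and P_mult: "\<And>x y. \<lbrakk>x \<in> A; y \<in> P\<rbrakk> \<Longrightarrow> x \<cdot> y \<in> P"
    and P_zero: "\<zero> \<in> P"
    using P unfolding ideal_def by blast+
  show ?thesis
  proof (rule idealI)
    show "?J \<subseteq> A"
      by blast
    show "\<zero> \<in> ?J"
      using b P_zero by (simp add: zero_closed zero_mult)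
    show "x \<in> ?J" if "x \<in> A" "y \<in> ?J" "x \<preceq> y" for x y
      using that b P_down[OF mult_closed _ mult_right_mono] by blast
    show "x \<oplus> y \<in> ?J" if "x \<in> ?J" "y \<in> ?J" for x y
      using that b P_down[OF mult_closed P_oplus oplus_mult] oplus_closed by blast
    show "x \<cdot> c \<in> ?J \<and> c \<cdot> x \<in> ?J" if "x \<in> ?J" "c \<in> A" for x c
      using that b P_mult[of c "x \<cdot> b"] mult_comm[of x c] by (simp add: mult_assoc mult_closed)
  qed
qed

text \<open>The analogue of Krull's separation lemma for rings: Zorn's lemma gives an ideal maximal
  among those disjoint from \<open>S\<close>, and multiplicative closure of \<open>S\<close> makes
  it prime.\<close>

lemma prime_ideal_disjoint_exists:
  assumes S: "S \<subseteq> A" "S \<noteq> {}" "\<zero> \<notin> S"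
    and S_mult: "\<forall>s\<in>S. \<forall>t\<in>S. s \<cdot> t \<in> S"
  obtains P where "prime_ideal P" "P \<inter> S = {}"
proof -
  let ?\<I> = "{I. ideal I \<and> I \<inter> S = {}}"
  have "\<exists>P\<in>?\<I>. \<forall>J\<in>?\<I>. P \<subseteq> J \<longrightarrow> J = P"
  proof (rule subset_Zorn_nonempty)
    show "?\<I> \<noteq> {}"
      using ideal_zero S(3) by blast
  next
    fix \<C> assume "\<C> \<noteq> {}" "subset.chain ?\<I> \<C>"
    then have "subset.chain {I. ideal I} \<C>" "\<Union>\<C> \<inter> S = {}"
      by (auto simp: subset_chain_def)
    then show "\<Union>\<C> \<in> ?\<I>"
      using ideal_Union_chain \<open>\<C> \<noteq> {}\<close> by blast
  qed
  then obtain P where "P \<in> ?\<I>" and P_max: "\<forall>J\<in>?\<I>. P \<subseteq> J \<longrightarrow> J = P"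
    by (rule bexE)
  then have P: "ideal P" "P \<inter> S = {}"
    by simp_all
  have maximal: "J = P" if "ideal J" "P \<subseteq> J" "J \<inter> S = {}" for J
    using P_max that by simp
  \<comment> \<open>Maximality is applied to colon ideals, which avoids describing the ideal generated by
    \<open>P\<close> and an element.\<close>
  have colon: "\<exists>s\<in>S. s \<cdot> y \<in> P" if xy: "x \<in> A" "y \<in> A" "x \<cdot> y \<in> P" "x \<notin> P" for x y
  proof (rule ccontr)
    assume "\<not> ?thesis"
    then have "{z \<in> A. z \<cdot> y \<in> P} \<inter> S = {}"
      by blast
    moreover have "P \<subseteq> {z \<in> A. z \<cdot> y \<in> P}"
      using P(1) \<open>y \<in> A\<close> unfolding ideal_def by blast
    ultimately have "{z \<in> A. z \<cdot> y \<in> P} = P"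
      using ideal_colon[OF P(1) \<open>y \<in> A\<close>] by (intro maximal)
    with xy show False
      by blast
  qed
  have "a \<in> P \<or> b \<in> P" if ab: "a \<in> A" "b \<in> A" "a \<cdot> b \<in> P" for a b
  proof (rule ccontr)
    assume neither: "\<not> (a \<in> P \<or> b \<in> P)"
    \<comment> \<open>The colon property replaces the factor \<open>a\<close> of
      \<open>a \<cdot> b\<close> by some \<open>s\<close> in \<open>S\<close>. After swapping
      factors it is used again to replace \<open>b\<close> by some \<open>t\<close> in
      \<open>S\<close>, so a product of two elements of \<open>S\<close> falls into
      \<open>P\<close>.\<close>
    then obtain s where s: "s \<in> S" "s \<cdot> b \<in> P"
      using colon ab by blast
    then have "b \<cdot> s \<in> P"
      using mult_comm ab(2) S(1) by (metis subsetD)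
    then obtain t where "t \<in> S" "t \<cdot> s \<in> P"
      using colon[of b s] ab(2) s(1) S(1) neither by blast
    then show False
      using S_mult s(1) P(2) by blast
  qed
  moreover have "P \<noteq> A"
    using S(1,2) P(2) by blast
  ultimately have "prime_ideal P"
    using P(1) by (simp add: prime_ideal_def)
  then show thesis
    using that P(2) by blast
qed

theorem compact_space_co_zariski:
  assumes one: "one \<in> A" "\<And>x. x \<in> A \<Longrightarrow> one \<cdot> x = x"
  shows "compact_space co_zariski"
  unfolding compact_space_alt topspace_co_zariski
proof (intro allI impI, elim conjE)
  fix \<U> assume opens: "\<forall>U\<in>\<U>. openin co_zariski U" and cover: "Spec \<subseteq> \<Union>\<U>"
  define S where "S = {s \<in> A. \<exists>\<F>. finite \<F> \<and> \<F> \<subseteq> \<U> \<and> V s \<subseteq> \<Union>\<F>}"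
  have "one \<in> S"
    \<comment> \<open>Since \<open>V one\<close> is empty, the empty subfamily covers it.\<close>
    using one V_one[of one] by (auto simp: S_def)
  have S_mult: "s \<cdot> t \<in> S" if st: "s \<in> S" "t \<in> S" for s t
  proof -
    obtain \<F> \<G> where "finite \<F>" "\<F> \<subseteq> \<U>" "V s \<subseteq> \<Union>\<F>" "finite \<G>" "\<G> \<subseteq> \<U>" "V t \<subseteq> \<Union>\<G>"
      and "s \<in> A" "t \<in> A"
      using st by (auto simp: S_def)
    then have "finite (\<F> \<union> \<G>)" "\<F> \<union> \<G> \<subseteq> \<U>" "V (s \<cdot> t) \<subseteq> \<Union>(\<F> \<union> \<G>)" "s \<cdot> t \<in> A"
      using V_mult_subset[of s t] by (auto simp: mult_closed)
    then show ?thesis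
      unfolding S_def by blast
  qed
  have "\<zero> \<in> S"
  proof (rule ccontr)
    assume "\<zero> \<notin> S"
    moreover have "S \<subseteq> A" "S \<noteq> {}"
      using \<open>one \<in> S\<close> by (auto simp: S_def)
    ultimately obtain P where P: "prime_ideal P" "P \<inter> S = {}"
      using prime_ideal_disjoint_exists[of S] S_mult by blast
    then obtain U where "U \<in> \<U>" "P \<in> U"
      using cover by (auto simp: Spec_def)
    then obtain a where a: "a \<in> A" "P \<in> V a" "V a \<subseteq> U"
      using opens openin_co_zariski_basic by blast
    \<comment> \<open>The single set \<open>U\<close> already covers \<open>V a\<close>, which puts
      \<open>a\<close> into \<open>S\<close> as well as into \<open>P\<close>.\<close>
    have "finite {U}" "{U} \<subseteq> \<U>" "V a \<subseteq> \<Union>{U}"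
      using a \<open>U \<in> \<U>\<close> by auto
    then have "a \<in> S"
      unfolding S_def using a(1) by blast
    then show False
      using P(2) a(2) by (auto simp: V_def)
  qed
  \<comment> \<open>As \<open>V \<zero>\<close> is the whole spectrum, membership of
    \<open>\<zero>\<close> in \<open>S\<close> is exactly the existence of a finite
    subcover.\<close>
  then show "\<exists>\<F>. finite \<F> \<and> \<F> \<subseteq> \<U> \<and> Spec \<subseteq> \<Union>\<F>"
    by (simp add: S_def V_zero)
qed

end

theorem theorem60:
  fixes A :: "'a set"
    and oplus mult :: "'a \<Rightarrow> 'a \<Rightarrow> 'a"
    and neg :: "'a \<Rightarrow> 'a"
    and zero one :: 'a
  assumes "mvw_rig A oplus neg zero mult"
    and "\<And>x y. \<lbrakk>x \<in> A; y \<in> A\<rbrakk> \<Longrightarrow> mult x y = mult y x"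
    and "one \<in> A"
    and "\<And>x. x \<in> A \<Longrightarrow> mult one x = x \<and> mult x one = x"
  shows "compact_space (mvw_rig.co_zariski A oplus neg zero mult)"
proof -
  interpret mvw_rig A oplus neg zero mult
    by (fact assms(1))
  interpret comm_mvw_rig A oplus neg zero mult
    by unfold_locales (fact assms(2))
  show ?thesis
    using assms(3,4) by (intro compact_space_co_zariski[of one]) simp_all
qed

end
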